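(* Let $f_1, f_2 \in \mathbf{R}[x,y,z]$ be two non-linear real polynomials in three variables such that the system $$f_1(x,y,z)=0 \quad\wedge\quad f_2(x,y,z)=0$$ is consistent. Let a monomial order on the monomials in $x,y,z$ be fixed. If a Groebner basis (with respect to this order) of the ideal $I=\langle f_1,f_2\rangle \subseteq \mathbf{C}[x,y,z]$ contains a linear polynomial $$g(x,y,z)=Ax+By+Cz+D$$ for some real constants $A,B,C,D$, then the solution of the system is planar: every solution of the system is also a solution of a linear equation, namely $g(x,y,z)=0$.
   Context: A system $f_1=0 \wedge f_2=0$ of two real polynomial equations in $x,y,z$ (considered in $\mathbf{R}^3$) is said to have a planar solution (equivalently, planar intersection) if there exists a linear polynomial $g=Ax+By+Cz+D$ with real constants $A,B,C,D$ such that every solution of the system is also a solution of $g(x,y,z)=0$. A Groebner basis of an ideal $I$ is a finite generating set $\{g_1,\dots,g_s\}$ of $I$ with $\langle LT(g_1),\dots,LT(g_s)\rangle=\langle LT(I)\rangle$, where $LT$ denotes the leading term with respect to the fixed monomial order and $\langle LT(I)\rangle$ is the ideal generated by the leading terms of all elements of $I$. A Groebner basis of the system means a Groebner basis of the ideal $\langle f_1,f_2\rangle$. *)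

theory Defs
  imports "HOL-Analysis.Analysis" "HOL-Library.Poly_Mapping"
begin

text \<open>
  The three variables \<open>x, y, z\<close> are indexed by the three-element type \<open>3\<close>, whose elements
  are written \<open>1\<close>, \<open>2\<close>, \<open>3\<close>. A monomial is its exponent vector, so that the additive structure
  of monomials is their multiplication, and a polynomial is a finitely supported coefficient
  function with the convolution product of \<^theory>\<open>HOL-Library.Poly_Mapping\<close>.
\<close>

type_synonym monomial = "3 \<Rightarrow>\<^sub>0 nat"
type_synonym 'a poly3 = "monomial \<Rightarrow>\<^sub>0 'a"

definition Const :: "'a::zero \<Rightarrow> 'a poly3" where
  "Const c = Poly_Mapping.single 0 c"

definition Var :: "3 \<Rightarrow> 'a::zero_neq_one poly3" where
  "Var i = Poly_Mapping.single (Poly_Mapping.single i 1) 1"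

definition eval :: "'a::comm_semiring_1 poly3 \<Rightarrow> 'a ^ 3 \<Rightarrow> 'a" where
  "eval f p = (\<Sum>m\<in>Poly_Mapping.keys f.
     Poly_Mapping.lookup f m * (\<Prod>i\<in>UNIV. (p $ i) ^ Poly_Mapping.lookup m i))"

definition complexify :: "real poly3 \<Rightarrow> complex poly3" where
  "complexify = Poly_Mapping.map complex_of_real"

text \<open>The coefficients are arbitrary here; degenerate cases are excluded where it matters.\<close>

definition linear_poly :: "real \<Rightarrow> real \<Rightarrow> real \<Rightarrow> real \<Rightarrow> real poly3" where
  "linear_poly A B C D = Const A * Var 1 + Const B * Var 2 + Const C * Var 3 + Const D"

definition nonlinear :: "real poly3 \<Rightarrow> bool" where
  "nonlinear f \<longleftrightarrow> \<not> (\<exists>A B C D. f = linear_poly A B C D)"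

definition solutions :: "real poly3 \<Rightarrow> real poly3 \<Rightarrow> (real ^ 3) set" where
  "solutions f1 f2 = {p. eval f1 p = 0 \<and> eval f2 p = 0}"

definition consistent :: "real poly3 \<Rightarrow> real poly3 \<Rightarrow> bool" where
  "consistent f1 f2 \<longleftrightarrow> solutions f1 f2 \<noteq> {}"

text \<open>Without \<open>(A, B, C) \<noteq> (0, 0, 0)\<close> the zero polynomial would make every system planar.\<close>

definition planar_solution :: "real poly3 \<Rightarrow> real poly3 \<Rightarrow> bool" where
  "planar_solution f1 f2 \<longleftrightarrow> (\<exists>A B C D. (A, B, C) \<noteq> (0, 0, 0) \<and>
     (\<forall>p \<in> solutions f1 f2. eval (linear_poly A B C D) p = 0))"

text \<open>A commutative ring is a module over itself; the submodules are the ideals.\<close>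

lemma module_self: "module ((*) :: 'a::comm_ring_1 \<Rightarrow> 'a \<Rightarrow> 'a)"
  by unfold_locales (simp_all add: algebra_simps)

definition ideal_gen :: "'a::comm_ring_1 set \<Rightarrow> 'a set" where
  "ideal_gen = module.span (*)"

text \<open>Monomial orders are given as sets of pairs \<open>(s, t)\<close> with \<open>s \<le> t\<close>.\<close>

definition monomial_order :: "monomial rel \<Rightarrow> bool" where
  "monomial_order r \<longleftrightarrow> well_order_on UNIV r \<and>
     (\<forall>s t u. (s, t) \<in> r \<longrightarrow> (s + u, t + u) \<in> r)"

definition leading_monomial :: "monomial rel \<Rightarrow> 'a::zero poly3 \<Rightarrow> monomial" where
  "leading_monomial r f =
     (THE m. m \<in> Poly_Mapping.keys f \<and> (\<forall>m' \<in> Poly_Mapping.keys f. (m', m) \<in> r))"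

text \<open>With the convention that the leading term of \<open>0\<close> is \<open>0\<close>, which contributes nothing
  to an ideal of leading terms.\<close>

definition LT :: "monomial rel \<Rightarrow> 'a::zero poly3 \<Rightarrow> 'a poly3" where
  "LT r f = (if f = 0 then 0
     else Poly_Mapping.single (leading_monomial r f)
            (Poly_Mapping.lookup f (leading_monomial r f)))"

definition groebner_basis ::
    "monomial rel \<Rightarrow> 'a::comm_ring_1 poly3 set \<Rightarrow> 'a poly3 set \<Rightarrow> bool" where
  "groebner_basis r G I \<longleftrightarrow>
     finite G \<and> ideal_gen G = I \<and> ideal_gen (LT r ` G) = ideal_gen (LT r ` I)"

end

theory Submission
  imports Defs
begin

text \<open>Every element of the ideal \<open>\<langle>f\<^sub>1, f\<^sub>2\<rangle>\<close> vanishes at the real points where \<open>f\<^sub>1\<close> and \<open>f\<^sub>2\<close> both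
  vanish, so the linear element does. It cannot be a nonzero constant, because the system is
  consistent.\<close>

text \<open>The monomial factor inside \<open>eval\<close>, named so that its multiplicativity can
  be stated separately.\<close>

definition monom_val :: "'a::comm_semiring_1 ^ 3 \<Rightarrow> monomial \<Rightarrow> 'a" where
  "monom_val p m = (\<Prod>i\<in>UNIV. (p $ i) ^ Poly_Mapping.lookup m i)"

lemma monom_val_0 [simp]: "monom_val p 0 = 1"
  by (simp add: monom_val_def)

lemma monom_val_add: "monom_val p (m + n) = monom_val p m * monom_val p n"
  by (simp add: monom_val_def lookup_add power_add prod.distrib)

lemma monom_val_single [simp]: "monom_val p (Poly_Mapping.single i 1) = p $ i"
proof -
  have "monom_val p (Poly_Mapping.single i 1) = (\<Prod>j\<in>UNIV. if j = i then p $ j else 1)"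
    unfolding monom_val_def by (intro prod.cong) (auto simp: lookup_single when_def)
  then show ?thesis by simp
qed

text \<open>Monomials outside the support contribute zero, so polynomials with different supports
  can be summed over one common index set.\<close>

lemma eval_superset:
  assumes "finite S" and "Poly_Mapping.keys f \<subseteq> S"
  shows "eval f p = (\<Sum>m\<in>S. Poly_Mapping.lookup f m * monom_val p m)"
  unfolding eval_def monom_val_def using assms
  by (intro sum.mono_neutral_left) (auto simp: in_keys_iff)

lemma eval_zero [simp]: "eval 0 p = 0"
  by (simp add: eval_def)

lemma eval_single [simp]: "eval (Poly_Mapping.single m c) p = c * monom_val p m"
  by (subst eval_superset[of "{m}"]) auto

lemma eval_add [simp]: "eval (f + g) p = eval f p + eval g p"
proof -
  let ?S = "Poly_Mapping.keys f \<union> Poly_Mapping.keys g"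
  have "Poly_Mapping.keys (f + g) \<subseteq> ?S"
    by (rule keys_add)
  then show ?thesis
    by (simp add: eval_superset[of ?S] lookup_add distrib_right sum.distrib)
qed

text \<open>Reduces claims that are additive in the polynomial to single terms.\<close>

lemma poly_mapping_single_add_induct [case_names single add]:
  assumes "\<And>k v. P (Poly_Mapping.single k v)" and "\<And>f g. P f \<Longrightarrow> P g \<Longrightarrow> P (f + g)"
  shows "P (f :: 'a \<Rightarrow>\<^sub>0 'b::comm_monoid_add)"
proof (induction f rule: update_induct)
  case const
  \<comment> \<open>A single term with coefficient 0 is the zero polynomial, whatever its
    key.\<close>
  show ?case using assms(1)[of undefined 0] by simp
next
  case (update f a b)
  \<comment> \<open>Since \<open>a\<close> is not a key of \<open>f\<close>, updating there
    overwrites only a zero.\<close>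
  have "Poly_Mapping.update a b f = Poly_Mapping.single a b + f"
    using update.hyps(1)
    by (intro poly_mapping_eqI) (auto simp: lookup_update lookup_add lookup_single in_keys_iff when_def)
  then show ?case using assms update.IH by simp
qed

text \<open>Both sides are additive in each factor, so two inductions leave a product of two terms,
  where \<open>monom_val_add\<close> applies.\<close>

lemma eval_mult [simp]: "eval (f * g) p = eval f p * eval g p"
proof (induction f rule: poly_mapping_single_add_induct)
  case (single m c)
  show ?case
    by (induction g rule: poly_mapping_single_add_induct)
      (simp_all add: mult_single monom_val_add algebra_simps)
qed (simp add: distrib_right)

lemma eval_linear_poly:
  "eval (linear_poly A B C D) p = A * p $ 1 + B * p $ 2 + C * p $ 3 + D"
  \<comment> \<open>The exponent must stay \<open>1\<close>, not \<open>Suc 0\<close>, for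
    \<open>monom_val_single\<close> to match.\<close>
  by (simp add: linear_poly_def Const_def Var_def del: One_nat_def)

text \<open>Carries vanishing between real polynomials and the complex ideal, at points with real
  coordinates.\<close>

lemma eval_complexify:
  "eval (complexify f) (\<chi> i. complex_of_real (p $ i)) = complex_of_real (eval f p)"
proof -
  have "Poly_Mapping.keys (complexify f) \<subseteq> Poly_Mapping.keys f"
    by (auto simp: complexify_def in_keys_iff map.rep_eq when_def)
  then show ?thesis
    by (simp add: eval_superset[of "Poly_Mapping.keys f"] monom_val_def complexify_def map.rep_eq when_def in_keys_iff)
qed

text \<open>The polynomials vanishing at \<open>p\<close> are closed under sums and under
  multiplication by any polynomial.\<close>

lemma eval_eq_0_of_mem_ideal_gen:
  fixes F :: "'a::comm_ring_1 poly3 set"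
  assumes "g \<in> ideal_gen F" and "\<And>f. f \<in> F \<Longrightarrow> eval f p = 0"
  shows "eval g p = 0"
  using assms(1) unfolding ideal_gen_def
  by (rule module.span_induct_alt[OF module_self]) (use assms(2) in simp_all)

theorem theorem2p1:
  fixes f1 f2 :: "real poly3"
    and r :: "monomial rel"
    and G :: "complex poly3 set"
    and A B C D :: real
  assumes "nonlinear f1" and "nonlinear f2"
    and "consistent f1 f2"
    and "monomial_order r"
    and "groebner_basis r G (ideal_gen {complexify f1, complexify f2})"
    and "complexify (linear_poly A B C D) \<in> G"
    and "(A, B, C, D) \<noteq> (0, 0, 0, 0)"
  shows "(A, B, C) \<noteq> (0, 0, 0) \<and>
    (\<forall>p \<in> solutions f1 f2. eval (linear_poly A B C D) p = 0) \<and>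
    planar_solution f1 f2"
proof -
  let ?g = "linear_poly A B C D"
  have "complexify ?g \<in> ideal_gen G"
    unfolding ideal_gen_def using assms(6) by (rule module.span_base[OF module_self])
  then have mem: "complexify ?g \<in> ideal_gen {complexify f1, complexify f2}"
    using assms(5) by (simp add: groebner_basis_def)
  have vanish: "eval ?g p = 0" if "p \<in> solutions f1 f2" for p
  proof -
    have "eval (complexify ?g) (\<chi> i. complex_of_real (p $ i)) = 0"
      using mem
    proof (rule eval_eq_0_of_mem_ideal_gen)
      fix f assume "f \<in> {complexify f1, complexify f2}"
      then show "eval f (\<chi> i. complex_of_real (p $ i)) = 0"
        using that by (auto simp: eval_complexify solutions_def)
    qed
    then show ?thesis by (simp add: eval_complexify)
  qed
  obtain q where "q \<in> solutions f1 f2"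
    using assms(3) by (auto simp: consistent_def)
  \<comment> \<open>If \<open>A\<close>, \<open>B\<close>, \<open>C\<close> were all zero, this
    equation would force \<open>D = 0\<close> as well.\<close>
  then have "A * q $ 1 + B * q $ 2 + C * q $ 3 + D = 0"
    using vanish by (simp add: eval_linear_poly)
  then have "(A, B, C) \<noteq> (0, 0, 0)"
    using assms(7) by auto
  with vanish show ?thesis
    unfolding planar_solution_def by blast
qed

end
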